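(* Let $m,s\ge1$ be integers, let $C_1,\dots,C_s\in\{0,1\}^{m\times m}$, and let $\boldsymbol{x}_0,\dots,\boldsymbol{x}_{2^m-1}\in[0,1)^s$ be the digital net in base $2$ generated by $C_1,\dots,C_s$. Then for every nonempty $u\subseteq\{1,\dots,s\}$ and every $\boldsymbol{k}\in\mathbb{N}_0^{|u|}$, the gain coefficient $\Gamma_{u,\boldsymbol{k}}$ is either $0$ or $2^{m-\mathrm{rank}(C_{u,\boldsymbol{k}})}$.
   Context: All matrix and vector arithmetic on bits, and all ranks, are over the field $\mathbb{Z}_2$. $\mathbb{N}_0$ is the set of non-negative integers. Digital net: for an integer $0\le i<2^m$ with $i=\sum_{\ell=1}^m i_\ell2^{\ell-1}$, $i_\ell\in\{0,1\}$, let $\vec{i}=(i_1,\dots,i_m)^{\mathsf T}$. The digital net generated by $C_1,\dots,C_s$ is $\boldsymbol{x}_i=(x_{i1},\dots,x_{is})$ with $x_{ij}=\sum_{\ell=1}^m x_{ij\ell}2^{-\ell}$, where $(x_{ij1},\dots,x_{ijm})^{\mathsf T}=C_j\vec{i}$ mod $2$. Matrices: $C_j(\ell,:)$ denotes row $\ell$ of $C_j$, with the convention that $C_j(\ell,:)$ is the zero row of length $m$ for $\ell>m$. For nonempty $u\subseteq\{1,\dots,s\}$ and $\boldsymbol{k}=(k_j)_{j\in u}\in\mathbb{N}_0^{|u|}$, $C_{u,\boldsymbol{k}}$ is the matrix with $|\boldsymbol{k}|=\sum_{j\in u}k_j$ rows and $m$ columns obtained by stacking the rows $C_j(\ell,:)$,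 $1\le\ell\le k_j$, for $j\in u$. Gain coefficients: let $n=2^m$. For $x,x'\in[0,1)$ let $M(x,x')=\max\{k\in\mathbb{N}_0: \lfloor 2^kx\rfloor=\lfloor 2^kx'\rfloor\}\in\mathbb{N}_0\cup\{\infty\}$ (equal to $\infty$ when $x=x'$). For nonempty $u\subseteq\{1,\dots,s\}$, $\boldsymbol{k}=(k_j)_{j\in u}\in\mathbb{N}_0^{|u|}$, $j\in u$ and $0\le i,i'<n$, put $N_{i,i',j}=0$ if $M(x_{ij},x_{i'j})<k_j$, $-1$ if $M(x_{ij},x_{i'j})=k_j$, and $1$ if $M(x_{ij},x_{i'j})>k_j$. Then $\Gamma_{u,\boldsymbol{k}}=\frac1n\sum_{i=0}^{n-1}\sum_{i'=0}^{n-1}\prod_{j\in u}N_{i,i',j}$. *)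

theory Defs
  imports "HOL-Library.Z2" "HOL-Library.Extended_Nat" "Jordan_Normal_Form.DL_Rank"
begin

text \<open>
  The field of two elements is the library type \<^typ>\<open>bit\<close>. Library vectors and matrices are
  indexed from 0, so entry \<open>l\<close> of \<open>index_vec m i\<close> is the binary digit of \<open>i\<close> of weight \<open>2 ^ l\<close>.
  The digit positions in \<open>digital_net\<close> and the row numbers in \<open>row_ext\<close> and \<open>stacked_mat\<close> count
  from 1, hence the shifts \<open>l - 1\<close>.
\<close>

definition index_vec :: "nat \<Rightarrow> nat \<Rightarrow> bit vec" where
  "index_vec m i = vec m (\<lambda>l. of_nat (i div 2 ^ l mod 2))"

definition digital_net :: "nat \<Rightarrow> (nat \<Rightarrow> bit mat) \<Rightarrow> nat \<Rightarrow> nat \<Rightarrow> real" where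
  "digital_net m C i j =
     (\<Sum>l = 1..m. of_bit ((C j *\<^sub>v index_vec m i) $ (l - 1)) / 2 ^ l)"

definition row_ext :: "'a :: zero mat \<Rightarrow> nat \<Rightarrow> 'a vec" where
  "row_ext A l = (if 1 \<le> l \<and> l \<le> dim_row A then row A (l - 1) else 0\<^sub>v (dim_col A))"

text \<open>
  A tuple \<open>(k\<^sub>j)\<close> indexed by \<open>j \<in> u\<close> is a function on \<^typ>\<open>nat\<close>, whose values outside \<open>u\<close>
  are never used. The blocks are stacked in increasing order of \<open>j\<close>.
\<close>

definition stacked_mat :: "nat \<Rightarrow> (nat \<Rightarrow> bit mat) \<Rightarrow> nat set \<Rightarrow> (nat \<Rightarrow> nat) \<Rightarrow> bit mat" where
  "stacked_mat m C u k =
     mat_of_rows m (concat (map (\<lambda>j. map (row_ext (C j)) [1..<Suc (k j)]) (sorted_list_of_set u)))"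

lemma stacked_mat_carrier:
  assumes "finite u"
  shows "stacked_mat m C u k \<in> carrier_mat (\<Sum>j\<in>u. k j) m"
proof (rule carrier_matI)
  have "dim_row (stacked_mat m C u k) = (\<Sum>j\<leftarrow>sorted_list_of_set u. k j)"
    by (simp add: stacked_mat_def length_concat comp_def del: upt_Suc)
  also have "\<dots> = (\<Sum>j\<in>u. k j)"
    using assms by (simp add: sum_list_distinct_conv_sum_set)
  finally show "dim_row (stacked_mat m C u k) = (\<Sum>j\<in>u. k j)" .
qed (simp add: stacked_mat_def)

definition common_digits :: "real \<Rightarrow> real \<Rightarrow> enat" where
  "common_digits x x' =
     (if x = x' then \<infinity> else enat (Max {k. \<lfloor>2 ^ k * x\<rfloor> = \<lfloor>2 ^ k * x'\<rfloor>}))"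

text \<open>On \<open>[0,1)\<close> the maximum above is that of a finite nonempty set.\<close>

lemma common_digits_set:
  fixes x x' :: real
  assumes "x \<in> {0..<1}" "x' \<in> {0..<1}" "x \<noteq> x'"
  shows "finite {k. \<lfloor>2 ^ k * x\<rfloor> = \<lfloor>2 ^ k * x'\<rfloor>}"
    and "{k. \<lfloor>2 ^ k * x\<rfloor> = \<lfloor>2 ^ k * x'\<rfloor>} \<noteq> {}"
proof -
  have "\<lfloor>x\<rfloor> = 0" "\<lfloor>x'\<rfloor> = 0"
    using assms(1,2) by (simp_all add: floor_eq_iff)
  then have "0 \<in> {k. \<lfloor>2 ^ k * x\<rfloor> = \<lfloor>2 ^ k * x'\<rfloor>}"
    by simp
  then show "{k. \<lfloor>2 ^ k * x\<rfloor> = \<lfloor>2 ^ k * x'\<rfloor>} \<noteq> {}" by blast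
  obtain N where N: "1 / \<bar>x - x'\<bar> < 2 ^ N"
    using real_arch_pow[of 2 "1 / \<bar>x - x'\<bar>"] by auto
  have "k < N" if k: "\<lfloor>2 ^ k * x\<rfloor> = \<lfloor>2 ^ k * x'\<rfloor>" for k
  proof (rule ccontr)
    assume "\<not> k < N"
    then have "(2::real) ^ N \<le> 2 ^ k" by (simp add: power_increasing)
    with N have "1 / \<bar>x - x'\<bar> < 2 ^ k" by linarith
    then have "1 < 2 ^ k * \<bar>x - x'\<bar>" using assms(3) by (simp add: field_simps)
    moreover have "2 ^ k * \<bar>x - x'\<bar> = \<bar>2 ^ k * x - 2 ^ k * x'\<bar>"
      by (metis abs_mult abs_of_pos right_diff_distrib zero_less_numeral zero_less_power)
    moreover have "\<bar>2 ^ k * x - 2 ^ k * x'\<bar> < 1" using k by linarith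
    ultimately show False by linarith
  qed
  then have "{k. \<lfloor>2 ^ k * x\<rfloor> = \<lfloor>2 ^ k * x'\<rfloor>} \<subseteq> {..<N}" by blast
  then show "finite {k. \<lfloor>2 ^ k * x\<rfloor> = \<lfloor>2 ^ k * x'\<rfloor>}"
    by (rule finite_subset) (rule finite_lessThan)
qed

definition gain_factor :: "nat \<Rightarrow> real \<Rightarrow> real \<Rightarrow> real" where
  "gain_factor k x x' =
     (if common_digits x x' < enat k then 0
      else if common_digits x x' = enat k then - 1
      else 1)"

definition gain_coeff :: "nat \<Rightarrow> (nat \<Rightarrow> nat \<Rightarrow> real) \<Rightarrow> nat set \<Rightarrow> (nat \<Rightarrow> nat) \<Rightarrow> real" where
  "gain_coeff n x u k =
     1 / real n * (\<Sum>i<n. \<Sum>i'<n. \<Prod>j\<in>u. gain_factor (k j) (x i j) (x i' j))"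

end

theory Submission
  imports Defs
begin

text \<open>
  The digits of a net point are linear in the index vector, so \<open>M (x\<^sub>i\<^sub>j, x\<^bsub>i'j\<^esub>)\<close> depends only on the
  sum \<open>z\<close> of the two index vectors. Hence \<open>\<Gamma>\<close> is the sum over all \<open>z\<close> in the kernel of \<open>C\<^bsub>u,k\<^esub>\<close> of the
  character \<open>\<chi> z\<close> with exponent \<open>\<Sum>\<^sub>j C\<^sub>j(k\<^sub>j + 1,:) \<bullet> z\<close>. Such a sum vanishes unless the character is trivial
  on the kernel, and then it counts the kernel.
\<close>

text \<open>Z2 rewrites \<open>+\<close> and \<open>*\<close> to bit operations, which would take sums out of reach of the ring lemmas.\<close>

declare add_bit_eq_xor [simp del] mult_bit_eq_and [simp del]

section \<open>Cardinalities of vector spaces, column spaces and kernels over a field\<close>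

lemma UNIV_bit: "(UNIV :: bit set) = {0, 1}"
  using bit.exhaust by blast

context vectorspace
begin

text \<open>Coordinates in a finite basis \<open>B\<close>: \<open>lincomb\<close> is a bijection
  onto the space from the functions \<open>B\<close> to \<open>K\<close>, taken extensional so that
  each vector has exactly one.\<close>

lemma card_carrier_eq_power_dim:
  assumes "fin_dim"
  shows "card (carrier V) = card (carrier K) ^ dim"
proof -
  obtain B where B: "finite B" "basis B"
    using finite_basis_exists assms by blast
  have BV: "B \<subseteq> carrier V" using B(2) by (simp add: basis_def)
  define F where "F = (B \<rightarrow>\<^sub>E carrier K)"
  have ex1: "\<exists>!a. a \<in> F \<and> lincomb a B = v" if "v \<in> carrier V" for v
    using basis_criterion[OF B(1) BV] B(2) that unfolding F_def by blast
  have closed: "lincomb a B \<in> carrier V" if "a \<in> F" for a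
    using that BV unfolding F_def by (intro lincomb_closed) auto
  have "bij_betw (\<lambda>a. lincomb a B) F (carrier V)"
  proof (rule bij_betwI')
    show "lincomb a B = lincomb a' B \<longleftrightarrow> a = a'" if "a \<in> F" "a' \<in> F" for a a'
      using ex1[OF closed[OF that(1)]] that by metis
    show "\<exists>a\<in>F. v = lincomb a B" if "v \<in> carrier V" for v
      using ex1[OF that] by metis
  qed (rule closed)
  then have "card (carrier V) = card F"
    by (simp add: bij_betw_same_card)
  also have "\<dots> = card (carrier K) ^ dim"
    using B by (simp add: F_def card_PiE dim_basis)
  finally show ?thesis .
qed

end

lemma card_carrier_vec_field:
  "card (carrier_vec n :: 'a :: field vec set) = card (UNIV :: 'a set) ^ n"
proof -
  interpret vec_space "TYPE('a)" n .
  show ?thesis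
    using card_carrier_eq_power_dim fin_dim dim_is_n by simp
qed

lemma (in vec_space) card_col_space:
  assumes A: "A \<in> carrier_mat n nc"
  shows "card (col_space A) = card (UNIV :: 'a set) ^ rank A"
proof -
  have cols: "set (cols A) \<subseteq> carrier_vec n" using A cols_dim by blast
  interpret W: vectorspace class_ring "vs (span (set (cols A)))"
    using span_is_subspace[of "set (cols A)"] cols by (intro subspace_is_vs) auto
  show ?thesis
    using W.card_carrier_eq_power_dim fin_dim_span_cols[OF A]
    by (simp add: rank_def col_space_def)
qed

lemma finite_carrier_vec_bit [simp]: "finite (carrier_vec n :: bit vec set)"
  \<comment> \<open>Infinite sets have cardinality 0, so the positive value \<open>2 ^ n\<close>
    forces finiteness.\<close>
  by (rule card_ge_0_finite) (simp add: card_carrier_vec_field UNIV_bit)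

text \<open>Rank-nullity in counting form: the fibres of \<open>A\<close> over its column space
  partition the domain, and each is a translate of the kernel.\<close>

lemma card_kernel_times_card_col_space:
  fixes A :: "'a :: field mat"
  assumes A: "A \<in> carrier_mat n nc" and finite_dom: "finite (carrier_vec nc :: 'a vec set)"
  shows "card {x \<in> carrier_vec nc. A *\<^sub>v x = 0\<^sub>v n} * card (UNIV :: 'a set) ^ vec_space.rank n A = card (UNIV :: 'a set) ^ nc"
proof -
  interpret vec_space "TYPE('a)" n .
  let ?K = "{x \<in> carrier_vec nc. A *\<^sub>v x = 0\<^sub>v n}"
  have im: "col_space A = (*\<^sub>v) A ` carrier_vec nc"
    using col_space_eq[OF A] A by (auto simp: image_iff)
  have fibre: "card {x \<in> carrier_vec nc. A *\<^sub>v x = y} = card ?K" if "y \<in> col_space A" for y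
  proof -
    obtain x0 where x0: "x0 \<in> carrier_vec nc" "A *\<^sub>v x0 = y" using \<open>y \<in> col_space A\<close> im by auto
    have "bij_betw (\<lambda>x. x0 + x) ?K {x \<in> carrier_vec nc. A *\<^sub>v x = y}"
    proof (rule bij_betw_byWitness[where f' = "\<lambda>x. x - x0"])
      show "\<forall>a\<in>?K. x0 + a - x0 = a" using x0 by (auto intro!: eq_vecI)
      show "\<forall>a'\<in>{x \<in> carrier_vec nc. A *\<^sub>v x = y}. x0 + (a' - x0) = a'" using x0 by (auto intro!: eq_vecI)
      show "(+) x0 ` ?K \<subseteq> {x \<in> carrier_vec nc. A *\<^sub>v x = y}"
        using x0 A by (auto simp: mult_add_distrib_mat_vec[OF A])
      show "(\<lambda>x. x - x0) ` {x \<in> carrier_vec nc. A *\<^sub>v x = y} \<subseteq> ?K"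
        using x0 A by (auto simp: mult_minus_distrib_mat_vec[OF A])
    qed
    then show ?thesis by (simp add: bij_betw_same_card)
  qed
  have "card (UNIV :: 'a set) ^ nc = (\<Sum>x\<in>(carrier_vec nc :: 'a vec set). 1)"
    by (simp add: card_carrier_vec_field)
  also have "\<dots> = (\<Sum>y\<in>col_space A. \<Sum>x\<in>{x \<in> carrier_vec nc. A *\<^sub>v x = y}. 1)"
    using finite_dom unfolding im by (subst sum.group) auto
  also have "\<dots> = (\<Sum>y\<in>col_space A. card ?K)"
    using fibre by (intro sum.cong) auto
  finally show ?thesis
    by (simp add: card_col_space[OF A])
qed

section \<open>Sums over index vectors and over characters\<close>

text \<open>Binary digits determine a number, which gives injectivity; surjectivity follows because
  both sides have \<open>2 ^ m\<close> elements.\<close>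

lemma bij_betw_index_vec: "bij_betw (index_vec m) {..<2 ^ m} (carrier_vec m)"
proof -
  have inj: "inj_on (index_vec m) {..<2 ^ m}"
  proof (rule inj_onI)
    fix i i' :: nat
    assume i: "i \<in> {..<2 ^ m}" "i' \<in> {..<2 ^ m}" and eq: "index_vec m i = index_vec m i'"
    show "i = i'"
    proof (rule bit_eqI)
      fix l
      show "bit i l = bit i' l"
      proof (cases "l < m")
        case True
        then have "(of_nat (i div 2 ^ l mod 2) :: bit) = of_nat (i' div 2 ^ l mod 2)"
          using arg_cong[OF eq, of "\<lambda>v. v $ l"] by (simp add: index_vec_def)
        then show ?thesis
          by (auto simp: bit_iff_odd mod2_eq_if split: if_splits)
      next
        case False
        \<comment> \<open>Positions from \<open>m\<close> on are not recorded by
          \<open>index_vec\<close>, but there both numbers have digit 0.\<close>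
        then have "(2::nat) ^ m \<le> 2 ^ l" by (simp add: power_increasing)
        with i have "i < 2 ^ l" "i' < 2 ^ l" by (auto intro: less_le_trans)
        then show ?thesis by (simp add: bit_iff_odd)
      qed
    qed
  qed
  moreover have "index_vec m ` {..<2 ^ m} \<subseteq> carrier_vec m"
    by (auto simp: index_vec_def)
  moreover have "card (index_vec m ` {..<2 ^ m}) = card (carrier_vec m :: bit vec set)"
    unfolding card_image[OF inj] card_carrier_vec_field by (simp add: UNIV_bit flip: numeral_2_eq_2)
  ultimately show ?thesis
    unfolding bij_betw_def by (intro conjI card_subset_eq) simp_all
qed

lemma bit_vec_add_self [simp]:
  fixes v :: "bit vec"
  assumes "v \<in> carrier_vec m" "w \<in> carrier_vec m"
  shows "v + (v + w) = w"
proof -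
  have *: "a + (a + b) = b" for a b :: bit by (cases a; cases b) auto
  show ?thesis using assms * by (auto intro!: eq_vecI)
qed

text \<open>In characteristic 2 a translation is its own inverse.\<close>

lemma bij_betw_bit_vec_translate:
  fixes v :: "bit vec"
  assumes "v \<in> carrier_vec m" "\<And>w. w \<in> S \<Longrightarrow> v + w \<in> S" "S \<subseteq> carrier_vec m"
  shows "bij_betw (\<lambda>w. v + w) S S"
proof -
  have "\<forall>w\<in>S. v + (v + w) = w" using assms(1,3) by auto
  then show ?thesis
    using assms(2) by (intro bij_betw_byWitness[where f' = "\<lambda>w. v + w"]) blast+
qed

text \<open>For fixed \<open>i\<close>, adding \<open>index_vec m i\<close> permutes all vectors, so
  the inner sum does not depend on \<open>i\<close>. The factor \<open>2 ^ m\<close> later cancels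
  the \<open>1 / n\<close> of \<open>gain_coeff\<close>.\<close>

lemma sum_index_vec_add:
  fixes f :: "bit vec \<Rightarrow> real"
  shows "(\<Sum>i<2 ^ m. \<Sum>i'<2 ^ m. f (index_vec m i + index_vec m i')) =
    2 ^ m * (\<Sum>z\<in>carrier_vec m. f z)"
proof -
  have "(\<Sum>i'<2 ^ m. f (index_vec m i + index_vec m i')) = (\<Sum>z\<in>carrier_vec m. f z)" for i
  proof -
    have "(\<Sum>i'<2 ^ m. f (index_vec m i + index_vec m i')) =
        (\<Sum>w\<in>carrier_vec m. f (index_vec m i + w))"
      by (rule sum.reindex_bij_betw[OF bij_betw_index_vec])
    also have "\<dots> = (\<Sum>z\<in>carrier_vec m. f z)"
      by (rule sum.reindex_bij_betw[OF bij_betw_bit_vec_translate])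
        (auto simp: index_vec_def)
    finally show ?thesis .
  qed
  then show ?thesis by simp
qed

text \<open>Character orthogonality: translating by some \<open>v\<close> with
  \<open>\<chi> v \<noteq> 1\<close> preserves the sum but also multiplies it by
  \<open>\<chi> v\<close>, so it is 0.\<close>

lemma sum_character_eq:
  fixes \<chi> :: "bit vec \<Rightarrow> real"
  assumes S: "S \<subseteq> carrier_vec m" "\<And>v w. v \<in> S \<Longrightarrow> w \<in> S \<Longrightarrow> v + w \<in> S"
    and mult: "\<And>v w. v \<in> S \<Longrightarrow> w \<in> S \<Longrightarrow> \<chi> (v + w) = \<chi> v * \<chi> w"
  shows "(\<Sum>z\<in>S. \<chi> z) \<in> {0, real (card S)}"
proof (cases "\<forall>z\<in>S. \<chi> z = 1")
  case False
  then obtain v where v: "v \<in> S" "\<chi> v \<noteq> 1" by blast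
  have "(\<Sum>z\<in>S. \<chi> z) = (\<Sum>z\<in>S. \<chi> (v + z))"
    using v S by (intro sum.reindex_bij_betw[symmetric] bij_betw_bit_vec_translate) auto
  also have "\<dots> = \<chi> v * (\<Sum>z\<in>S. \<chi> z)"
    using v mult by (simp add: sum_distrib_left)
  finally show ?thesis using v by auto
qed simp

section \<open>Floors, binary digits and gain factors\<close>

lemma floor_binary_sum:
  fixes b :: "nat \<Rightarrow> bool"
  assumes "k \<le> N"
  shows "\<lfloor>2 ^ k * (\<Sum>l = 1..N. of_bool (b l) / 2 ^ l :: real)\<rfloor> =
    (\<Sum>l = 1..k. of_bool (b l) * 2 ^ (k - l))"
proof -
  \<comment> \<open>Equality holds for a tail of ones. The subtracted \<open>1 / 2 ^ N\<close> keeps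
    the scaled tail strictly below 1, as the floor requires.\<close>
  have tail: "(\<Sum>l = Suc k..N. of_bool (b l) / 2 ^ l :: real) \<le> 1 / 2 ^ k - 1 / 2 ^ N"
    using assms
  proof (induction N rule: dec_induct)
    case (step n)
    have "of_bool (b (Suc n)) / 2 ^ Suc n \<le> (1 / 2 ^ n - 1 / 2 ^ Suc n :: real)"
      by (auto simp: field_simps)
    with step show ?case by simp
  qed simp
  have split: "(\<Sum>l = 1..N. of_bool (b l) / 2 ^ l :: real) =
      (\<Sum>l = 1..k. of_bool (b l) / 2 ^ l) + (\<Sum>l = Suc k..N. of_bool (b l) / 2 ^ l)"
    using assms sum.ub_add_nat[of 1 k _ "N - k"] by simp
  have head: "2 ^ k * (\<Sum>l = 1..k. of_bool (b l) / 2 ^ l :: real) =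
      of_int (\<Sum>l = 1..k. of_bool (b l) * 2 ^ (k - l))"
    unfolding sum_distrib_left of_int_sum
  proof (intro sum.cong refl)
    fix l assume "l \<in> {1..k}"
    then have "(2::real) ^ k = 2 ^ l * 2 ^ (k - l)" by (simp flip: power_add)
    then show "2 ^ k * (of_bool (b l) / 2 ^ l) = real_of_int (of_bool (b l) * 2 ^ (k - l))"
      by (cases "b l") auto
  qed
  have "0 \<le> (\<Sum>l = Suc k..N. of_bool (b l) / 2 ^ l :: real)"
    by (intro sum_nonneg) auto
  moreover have "2 ^ k * (\<Sum>l = Suc k..N. of_bool (b l) / 2 ^ l :: real) < 2 ^ k * (1 / 2 ^ k)"
    by (intro mult_strict_left_mono le_less_trans[OF tail]) auto
  ultimately show ?thesis
    unfolding split distrib_left head by (intro floor_eq_iff[THEN iffD2]) auto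
qed

text \<open>Uniqueness of binary expansions: the last digit is the parity, and halving leaves the
  expansion of length one less.\<close>

lemma binary_sum_eq_iff:
  fixes b b' :: "nat \<Rightarrow> bool"
  shows "(\<Sum>l = 1..k. of_bool (b l) * 2 ^ (k - l) :: int) = (\<Sum>l = 1..k. of_bool (b' l) * 2 ^ (k - l))
    \<longleftrightarrow> (\<forall>l\<in>{1..k}. b l = b' l)"
proof (induction k)
  case (Suc k)
  have rec: "(\<Sum>l = 1..Suc k. of_bool (c l) * 2 ^ (Suc k - l) :: int) =
      2 * (\<Sum>l = 1..k. of_bool (c l) * 2 ^ (k - l)) + of_bool (c (Suc k))" for c :: "nat \<Rightarrow> bool"
    by (auto simp: sum_distrib_left Suc_diff_le intro!: sum.cong)
  have parity: "2 * x + of_bool p = 2 * y + of_bool q \<longleftrightarrow> x = y \<and> p = q" for x y :: int and p q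
    by (cases p; cases q; simp; presburger)
  show ?case
    unfolding rec parity Suc.IH by (auto simp: atLeastAtMostSuc_conv)
qed simp

text \<open>The set under \<open>Max\<close> is closed downwards, so being at most its maximum is
  the same as membership.\<close>

lemma le_common_digits_iff:
  assumes "x \<in> {0..<1}" "x' \<in> {0..<1}"
  shows "enat k \<le> common_digits x x' \<longleftrightarrow> \<lfloor>2 ^ k * x\<rfloor> = \<lfloor>2 ^ k * x'\<rfloor>"
proof (cases "x = x'")
  case False
  let ?S = "{k. \<lfloor>2 ^ k * x\<rfloor> = \<lfloor>2 ^ k * x'\<rfloor>}"
  note S = common_digits_set[OF assms False]
  have down: "l \<in> ?S" if "l \<le> k" "k \<in> ?S" for k l
  proof -
    \<comment> \<open>The coarser floor is an integer quotient of the finer one, so equality at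
      \<open>k\<close> passes down to \<open>l\<close>.\<close>
    have *: "\<lfloor>2 ^ l * y\<rfloor> = \<lfloor>2 ^ k * y\<rfloor> div 2 ^ (k - l)" for y :: real
    proof -
      have "2 ^ l * y = 2 ^ k * y / real_of_int (2 ^ (k - l))"
        using \<open>l \<le> k\<close> power_add[of "2::real" l "k - l"] by simp
      then show ?thesis
        using floor_divide_real_eq_div[of "2 ^ (k - l)" "2 ^ k * y"] by simp
    qed
    show ?thesis using that *[of x] *[of x'] by simp
  qed
  have "k \<le> Max ?S \<longleftrightarrow> k \<in> ?S"
    using S down Max_in[OF S] by (auto intro: Max_ge)
  with False show ?thesis by (simp add: common_digits_def)
qed (simp add: common_digits_def)

lemma gain_factor_eq:
  assumes "x \<in> {0..<1}" "x' \<in> {0..<1}"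
  shows "gain_factor k x x' =
    (if \<lfloor>2 ^ k * x\<rfloor> \<noteq> \<lfloor>2 ^ k * x'\<rfloor> then 0
     else if \<lfloor>2 ^ Suc k * x\<rfloor> \<noteq> \<lfloor>2 ^ Suc k * x'\<rfloor> then - 1 else 1)"
proof -
  have "common_digits x x' = enat k \<longleftrightarrow>
      enat k \<le> common_digits x x' \<and> \<not> enat (Suc k) \<le> common_digits x x'"
    by (cases "common_digits x x'") auto
  then show ?thesis
    unfolding gain_factor_def le_common_digits_iff[OF assms, symmetric]
    by (auto simp: not_le)
qed

section \<open>Digits of the net as scalar products with matrix rows\<close>

lemma row_ext_carrier:
  assumes "A \<in> carrier_mat nr m"
  shows "row_ext A l \<in> carrier_vec m"
  using assms by (auto simp: row_ext_def)

text \<open>Zero rows beyond \<open>m\<close> pad the expansion to any length \<open>N\<close>, so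
  that \<open>k\<close> may exceed \<open>m\<close> later on.\<close>

lemma digital_net_eq_sum:
  assumes C: "C j \<in> carrier_mat m m" and "m \<le> N"
  shows "digital_net m C i j =
    (\<Sum>l = 1..N. of_bit (row_ext (C j) l \<bullet> index_vec m i) / 2 ^ l)"
proof -
  have "digital_net m C i j = (\<Sum>l = 1..m. of_bit (row_ext (C j) l \<bullet> index_vec m i) / 2 ^ l)"
    unfolding digital_net_def using C by (intro sum.cong) (auto simp: row_ext_def)
  also have "\<dots> = (\<Sum>l = 1..N. of_bit (row_ext (C j) l \<bullet> index_vec m i) / 2 ^ l)"
    using C \<open>m \<le> N\<close> by (intro sum.mono_neutral_left) (auto simp: row_ext_def index_vec_def)
  finally show ?thesis .
qed

lemma floor_digital_net_eq_iff:
  assumes C: "C j \<in> carrier_mat m m"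
  shows "\<lfloor>2 ^ k * digital_net m C i j\<rfloor> = \<lfloor>2 ^ k * digital_net m C i' j\<rfloor> \<longleftrightarrow>
    (\<forall>l\<in>{1..k}. row_ext (C j) l \<bullet> (index_vec m i + index_vec m i') = 0)"
proof -
  \<comment> \<open>The real digits are \<open>of_bool (odd a)\<close>; two bits agree exactly when
    their sum vanishes.\<close>
  have bit: "odd a = odd b \<longleftrightarrow> a + b = 0" for a b :: bit
    by (cases a; cases b) auto
  have "row_ext (C j) l \<bullet> (index_vec m i + index_vec m i') =
      row_ext (C j) l \<bullet> index_vec m i + row_ext (C j) l \<bullet> index_vec m i'" for l
    using row_ext_carrier[OF C] by (intro scalar_prod_add_distrib) (auto simp: index_vec_def)
  then show ?thesis
    unfolding digital_net_eq_sum[of C j m "max m k", OF C max.cobounded1]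
      floor_binary_sum[OF max.cobounded2] binary_sum_eq_iff bit by simp
qed

lemma digital_net_in_unit_interval:
  assumes C: "C j \<in> carrier_mat m m"
  shows "digital_net m C i j \<in> {0..<1}"
proof -
  have "\<lfloor>digital_net m C i j\<rfloor> = 0"
    using floor_binary_sum[of 0 m] unfolding digital_net_eq_sum[of C j m m, OF C order_refl] by simp
  then show ?thesis by (simp add: floor_eq_iff)
qed

text \<open>Indicator and sign are kept as separate factors: over \<open>u\<close>, the indicators
  multiply to kernel membership and the signs to a character.\<close>

lemma gain_factor_digital_net:
  assumes C: "C j \<in> carrier_mat m m"
    and z: "z = index_vec m i + index_vec m i'"
  shows "gain_factor k (digital_net m C i j) (digital_net m C i' j) =
    of_bool (\<forall>l\<in>{1..k}. row_ext (C j) l \<bullet> z = 0) *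
      (if row_ext (C j) (Suc k) \<bullet> z = 0 then 1 else - 1)"
  unfolding gain_factor_eq[OF digital_net_in_unit_interval[of C j, OF C]
      digital_net_in_unit_interval[of C j, OF C]] floor_digital_net_eq_iff[of C j, OF C] z
  by (auto simp: atLeastAtMostSuc_conv)

section \<open>The kernel of the stacked matrix and the gain coefficient\<close>

lemma mat_of_rows_mult_eq_zero_iff:
  assumes "set rs \<subseteq> carrier_vec n"
  shows "mat_of_rows n rs *\<^sub>v x = 0\<^sub>v (length rs) \<longleftrightarrow> (\<forall>r\<in>set rs. r \<bullet> x = 0)"
proof -
  have "row (mat_of_rows n rs) i = rs ! i" if "i < length rs" for i
    using assms that by (intro mat_of_rows_row) auto
  then show ?thesis
    by (auto simp: vec_eq_iff all_set_conv_all_nth)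
qed

lemma stacked_mat_kernel:
  assumes "finite u" and C: "\<And>j. j \<in> u \<Longrightarrow> C j \<in> carrier_mat m m"
  shows "stacked_mat m C u k *\<^sub>v z = 0\<^sub>v (\<Sum>j\<in>u. k j) \<longleftrightarrow>
    (\<forall>j\<in>u. \<forall>l\<in>{1..k j}. row_ext (C j) l \<bullet> z = 0)"
proof -
  let ?rs = "concat (map (\<lambda>j. map (row_ext (C j)) [1..<Suc (k j)]) (sorted_list_of_set u))"
  have len: "length ?rs = (\<Sum>j\<in>u. k j)"
    using carrier_matD(1)[OF stacked_mat_carrier[OF \<open>finite u\<close>, of m C k]]
    by (simp add: stacked_mat_def del: upt_Suc)
  have set: "set ?rs = (\<Union>j\<in>u. row_ext (C j) ` {1..k j})"
    using \<open>finite u\<close> by (simp add: atLeastLessThanSuc_atLeastAtMost del: upt_Suc)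
  have "set ?rs \<subseteq> carrier_vec m"
    unfolding set using row_ext_carrier[OF C] by auto
  from mat_of_rows_mult_eq_zero_iff[OF this, of z] show ?thesis
    unfolding stacked_mat_def len set by blast
qed

theorem theorem2:
  fixes m s :: nat and C :: "nat \<Rightarrow> bit mat" and u :: "nat set" and k :: "nat \<Rightarrow> nat"
  assumes "m \<ge> 1" and "s \<ge> 1"
    and "\<And>j. j \<in> {1..s} \<Longrightarrow> C j \<in> carrier_mat m m"
    and "u \<subseteq> {1..s}" and "u \<noteq> {}"
  shows "gain_coeff (2 ^ m) (digital_net m C) u k \<in>
    {0, 2 powi (int m - int (vec_space.rank (\<Sum>j\<in>u. k j) (stacked_mat m C u k)))}"
proof -
  have fin: "finite u" using assms(4) finite_subset by blast
  have C: "C j \<in> carrier_mat m m" if "j \<in> u" for j using assms(3,4) that by blast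
  let ?A = "stacked_mat m C u k" and ?r = "\<Sum>j\<in>u. k j"
  define S where "S = {z \<in> carrier_vec m. ?A *\<^sub>v z = 0\<^sub>v ?r}"
  define \<chi> :: "bit vec \<Rightarrow> real" where
    \<comment> \<open>Row \<open>k j + 1\<close> is the first one not in block \<open>j\<close> of
      the stacked matrix; it decides between the values 1 and -1 of the gain factor.\<close>
    "\<chi> z = (\<Prod>j\<in>u. if row_ext (C j) (Suc (k j)) \<bullet> z = 0 then 1 else - 1)" for z
  have A: "?A \<in> carrier_mat ?r m"
    using fin by (rule stacked_mat_carrier)
  have "(\<Prod>j\<in>u. gain_factor (k j) (digital_net m C i j) (digital_net m C i' j)) =
      of_bool (index_vec m i + index_vec m i' \<in> S) * \<chi> (index_vec m i + index_vec m i')" for i i'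
  proof -
    define z where "z = index_vec m i + index_vec m i'"
    have "z \<in> carrier_vec m" by (auto simp: z_def index_vec_def)
    then have "z \<in> S \<longleftrightarrow> (\<forall>j\<in>u. \<forall>l\<in>{1..k j}. row_ext (C j) l \<bullet> z = 0)"
      using stacked_mat_kernel[OF fin C, where z = z and k = k] by (simp add: S_def)
    then have "(\<Prod>j\<in>u. of_bool (\<forall>l\<in>{1..k j}. row_ext (C j) l \<bullet> z = 0)) = (of_bool (z \<in> S) :: real)"
      using fin by (auto simp del: of_bool_eq_0_iff)
    then show ?thesis
      unfolding z_def[symmetric] \<chi>_def
      by (simp add: gain_factor_digital_net[OF C z_def] prod.distrib)
  qed
  then have "gain_coeff (2 ^ m) (digital_net m C) u k =
      (\<Sum>z\<in>carrier_vec m. of_bool (z \<in> S) * \<chi> z)"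
    using sum_index_vec_add[of "\<lambda>z. of_bool (z \<in> S) * \<chi> z" m] by (simp add: gain_coeff_def)
  also have "\<dots> = (\<Sum>z\<in>S. \<chi> z)"
    by (intro sum.mono_neutral_cong_right) (auto simp: S_def)
  finally have gain: "gain_coeff (2 ^ m) (digital_net m C) u k = (\<Sum>z\<in>S. \<chi> z)" .
  have "\<chi> (v + w) = \<chi> v * \<chi> w" if "v \<in> S" "w \<in> S" for v w
  proof -
    \<comment> \<open>The sign is a homomorphism from the additive group of bits to the group of 1
      and -1.\<close>
    have bit: "(if a + b = 0 then 1 else - 1) = (if a = 0 then 1 else - 1) * (if b = 0 then 1 else - 1 :: real)"
      for a b :: bit by (cases a; cases b) auto
    have "row_ext (C j) l \<bullet> (v + w) = row_ext (C j) l \<bullet> v + row_ext (C j) l \<bullet> w" if "j \<in> u" for j l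
      using row_ext_carrier[OF C[OF that]] \<open>v \<in> S\<close> \<open>w \<in> S\<close>
      by (intro scalar_prod_add_distrib) (auto simp: S_def)
    then show ?thesis
      unfolding \<chi>_def prod.distrib[symmetric] by (intro prod.cong) (simp_all only: bit)
  qed
  then have "(\<Sum>z\<in>S. \<chi> z) \<in> {0, real (card S)}"
    using A by (intro sum_character_eq[of S m]) (auto simp: S_def mult_add_distrib_mat_vec[OF A])
  moreover have "real (card S) = 2 powi (int m - int (vec_space.rank ?r ?A))"
  proof -
    have "card S * 2 ^ vec_space.rank ?r ?A = 2 ^ m"
      using card_kernel_times_card_col_space[OF A]
      by (simp add: S_def UNIV_bit flip: numeral_2_eq_2)
    then have "real (card S) * 2 ^ vec_space.rank ?r ?A = 2 ^ m"
      by (metis of_nat_mult of_nat_numeral of_nat_power)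
    \<comment> \<open>Dividing by the power of the rank gives the claim; the integer exponent avoids
      truncated subtraction.\<close>
    then show ?thesis
      by (simp add: power_int_diff field_simps)
  qed
  ultimately show ?thesis using gain by simp
qed

end
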